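(* Let $p$ and $q$ be distinct positive integers. Let $A$ be an algebra with a right identity $u$, and let $T: A\rightarrow A$ be a map. Then the following assertions are equivalent. (a) $T\in C_{p,q}(A)$. (b) $T=\rho_{T(u)}\in C_{ts}(A)$. (c) For every $a, b\in A$, $aT(b)=T(a)b$. In this case, $T$ is linear.
   Context: Algebras are associative, over the complex field, not necessarily commutative or unital. A right identity of $A$ is an element $u\in A$ with $au=a$ for all $a\in A$. A map $T:A\to A$ (not assumed linear or additive) is a $(p,q)$-centralizer if $(p+q)T(ab)=pT(a)b+q\,aT(b)$ for all $a,b\in A$; $C_{p,q}(A)$ is the set of all $(p,q)$-centralizers of $A$. $T$ is a two-sided centralizer if $T(ab)=T(a)b$ and $T(ab)=aT(b)$ for all $a,b\in A$; $C_{ts}(A)$ is the set of all two-sided centralizers. For $a\in A$, $\rho_a:A\to A$ is the map $\rho_a(b)=ba$. *)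

theory Defs
  imports Complex_Main
begin

text \<open>
  Associative complex algebras, neither unital nor commutative in general. The class \<open>ring\<close>
  supplies addition and an associative, distributive multiplication (no unit); the scalar action
  is an explicit parameter, since the library has type classes for algebras over the reals only.
\<close>

locale complex_algebra = vector_space scale
  for scale :: "complex \<Rightarrow> 'a::ring \<Rightarrow> 'a" +
  assumes mult_scale_left: "scale c a * b = scale c (a * b)"
    and mult_scale_right: "a * scale c b = scale c (a * b)"

definition right_identity :: "'a::ring \<Rightarrow> bool" where
  "right_identity u \<longleftrightarrow> (\<forall>a. a * u = a)"

text \<open>The maps below are arbitrary functions; neither linearity nor additivity is imposed.\<close>

definition pq_centralizers ::
  "(complex \<Rightarrow> 'a::ring \<Rightarrow> 'a) \<Rightarrow> nat \<Rightarrow> nat \<Rightarrow> ('a \<Rightarrow> 'a) set" where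
  "pq_centralizers scale p q =
     {T. \<forall>a b. scale (of_nat (p + q)) (T (a * b)) =
               scale (of_nat p) (T a * b) + scale (of_nat q) (a * T b)}"

definition two_sided_centralizers :: "('a::ring \<Rightarrow> 'a) set" where
  "two_sided_centralizers = {T. (\<forall>a b. T (a * b) = T a * b) \<and> (\<forall>a b. T (a * b) = a * T b)}"

definition right_mult :: "'a::ring \<Rightarrow> 'a \<Rightarrow> 'a" where
  "right_mult a = (\<lambda>b. b * a)"

end

theory Submission imports Defs begin

text \<open>
  Putting \<open>b = u\<close> in the centralizer identity cancels the \<open>p\<close>-terms and leaves \<open>T a = a * T u\<close>.
  Substituting this back cancels the \<open>q\<close>-terms and leaves \<open>a * b * T u = a * T u * b\<close>, that is
  \<open>a * T b = T a * b\<close>.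
\<close>

text \<open>Taking \<open>b = u\<close> in the balance identity gives
  \<open>a * T u = T a * u\<close>, and \<open>u\<close> is absorbed on the right.\<close>

lemma balanced_eq_right_mult:
  assumes "right_identity u" and "\<And>a b. a * T b = T a * b"
  shows "T = right_mult (T u)"
proof
  fix a
  show "T a = right_mult (T u) a"
    using assms(2)[of a u] assms(1) by (simp only: right_identity_def right_mult_def)
qed

text \<open>Once \<open>T\<close> is right multiplication by \<open>T u\<close>, associativity
  yields \<open>T (a * b) = a * T b\<close>; balance then turns this into the other centralizer
  law.\<close>

lemma balanced_two_sided:
  fixes T :: "'a::ring \<Rightarrow> 'a"
  assumes "right_identity (u :: 'a)" and "\<And>a b. a * T b = T a * b"
  shows "T \<in> two_sided_centralizers"
proof -
  have T: "T a = a * T u" for a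
    using assms(2)[of a u] assms(1) by (simp only: right_identity_def)
  have "T (a * b) = a * T b" for a b
    unfolding T[of "a * b"] T[of b] by (rule mult.assoc)
  with assms(2) show ?thesis by (simp add: two_sided_centralizers_def)
qed

context complex_algebra
begin

text \<open>Both products on the right equal \<open>T (a * b)\<close>, so their weights add up to
  \<open>p + q\<close>.\<close>

lemma two_sided_subset_pq: "two_sided_centralizers \<subseteq> pq_centralizers scale p q"
proof
  fix T :: "'a \<Rightarrow> 'a"
  assume "T \<in> two_sided_centralizers"
  then have "T a * b = T (a * b)" and "a * T b = T (a * b)" for a b
    unfolding two_sided_centralizers_def mem_Collect_eq by metis+
  then show "T \<in> pq_centralizers scale p q"
    by (simp add: pq_centralizers_def scale_left_distrib)
qed

lemma pq_right_identity:
  assumes "T \<in> pq_centralizers scale p q" and "q > 0" and "right_identity u"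
  shows "T a = a * T u"
proof -
  have "scale (of_nat (p + q)) (T (a * u)) = scale (of_nat p) (T a * u) + scale (of_nat q) (a * T u)"
    using assms(1) by (simp add: pq_centralizers_def)
  with assms(3) have "scale (of_nat q) (T a) = scale (of_nat q) (a * T u)"
    by (simp add: right_identity_def scale_left_distrib)
  \<comment> \<open>The scalar \<open>of_nat q\<close> is nonzero in the complex field, hence
    cancels.\<close>
  with assms(2) show ?thesis by simp
qed

lemma pq_balanced:
  fixes T :: "'a \<Rightarrow> 'a"
  assumes "T \<in> pq_centralizers scale p q" and "p > 0" and "q > 0" and "right_identity (u :: 'a)"
  shows "a * T b = T a * b"
proof -
  note T = pq_right_identity[OF assms(1,3,4)]
  \<comment> \<open>This makes the \<open>q\<close>-terms on the two sides of the centralizer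
    identity agree, leaving only the \<open>p\<close>-terms.\<close>
  have aTb: "T (a * b) = a * T b"
    unfolding T[of "a * b"] T[of b] by (rule mult.assoc)
  have "scale (of_nat (p + q)) (T (a * b)) = scale (of_nat p) (T a * b) + scale (of_nat q) (a * T b)"
    using assms(1) by (simp add: pq_centralizers_def)
  then have "scale (of_nat p) (a * T b) = scale (of_nat p) (T a * b)"
    by (simp add: aTb scale_left_distrib)
  with assms(2) show ?thesis by simp
qed

text \<open>Source of the linearity claim: a centralizer is a right multiplication, and those
  inherit linearity from the algebra product.\<close>

lemma linear_right_mult: "Vector_Spaces.linear scale scale (right_mult a)"
  by unfold_locales
    (simp_all add: right_mult_def distrib_right mult_scale_left scale_right_distrib scale_left_distrib)

end

theorem theorem2p1:
  fixes scale :: "complex \<Rightarrow> 'a::ring \<Rightarrow> 'a"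
    and p q :: nat
    and u :: 'a
    and T :: "'a \<Rightarrow> 'a"
  assumes "complex_algebra scale"
    and "p > 0" and "q > 0" and "p \<noteq> q"
    and "right_identity u"
  shows "(T \<in> pq_centralizers scale p q \<longleftrightarrow>
            T = right_mult (T u) \<and> right_mult (T u) \<in> two_sided_centralizers) \<and>
         (T \<in> pq_centralizers scale p q \<longleftrightarrow> (\<forall>a b. a * T b = T a * b)) \<and>
         (T \<in> pq_centralizers scale p q \<longrightarrow> Vector_Spaces.linear scale scale T)"
proof -
  interpret complex_algebra scale by fact
  have ac: "a * T b = T a * b" if "T \<in> pq_centralizers scale p q" for a b
    using pq_balanced[OF that assms(2,3,5)] .
  have cb: "T = right_mult (T u) \<and> right_mult (T u) \<in> two_sided_centralizers"
    if c: "\<forall>a b. a * T b = T a * b"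
  proof -
    have T: "T = right_mult (T u)"
      by (rule balanced_eq_right_mult[OF assms(5) c[rule_format]])
    moreover have "T \<in> two_sided_centralizers"
      by (rule balanced_two_sided[OF assms(5) c[rule_format]])
    ultimately show ?thesis by metis
  qed
  have ba: "T \<in> pq_centralizers scale p q"
    if "T = right_mult (T u) \<and> right_mult (T u) \<in> two_sided_centralizers"
    using that two_sided_subset_pq by (metis subsetD)
  have lin: "Vector_Spaces.linear scale scale T" if "T = right_mult (T u)"
    by (subst that) (rule linear_right_mult)
  \<comment> \<open>The implications close the cycle (a) to (c) to (b) to (a); linearity is read off
    from (b).\<close>
  from ac cb ba lin show ?thesis by blast
qed

end
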